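(* Let $n\ge 2$, and consider a system of first order autonomous ordinary differential equations $$\frac{dx_i}{dt}=f_i(x_1,\dots,x_n)\qquad(i=1,\dots,n)$$ on an open set $U\subseteq\mathbb{R}^{n+1}$ with coordinates $(t,x_1,\dots,x_n)$. For $i\neq j$ put $$\ell_{ij}=f_j\,\frac{\partial \ln|f_i|}{\partial x_j},$$ where all $f_i$ and $\ell_{12}$ are nowhere zero. Then the web geometry of this system, i.e. its equivalence problem under the pseudo-group of web transformations $\Phi(t,x_1,\dots,x_n)=(\varphi_0(t),\varphi_1(x_1),\dots,\varphi_n(x_n))$, is equivalent to the $\{e\}$-equivalence problem with coframe $$\theta^0=dt,\qquad \theta^i=\frac{dx_i}{\ell_{12}\,f_i}\quad(i=1,\dots,n),$$ with structure equations $$d\theta^0=-\sum_{i=1}^n\frac{\partial \ell_{12}}{\partial x_i}\;\theta^0\wedge\theta^i,\qquad d\theta^i=\sum_{j=1}^n\left(\frac{\ell_{ij}}{\ell_{12}}-\frac{\partial \ell_{12}}{\partial x_j}\right)\theta^i\wedge\theta^j\quad(i=1,\dots,n).$$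
   Context: The functions $f_i$ are smooth and depend on $(x_1,\dots,x_n)$ only. The $j=i$ term in the last sum is zero because $\theta^i\wedge\theta^i=0$, so $\ell_{ii}$ is not needed. The equivalence problem under web transformations: given a second system $dX_i/dT=F_i(X_1,\dots,X_n)$ $(i=1,\dots,n)$ on an open set $V\subseteq\mathbb{R}^{n+1}$ with coordinates $(T,X_1,\dots,X_n)$, decide whether there is a diffeomorphism $\Phi:U\to V$ of the form $\Phi(t,x_1,\dots,x_n)=(\varphi_0(t),\varphi_1(x_1),\dots,\varphi_n(x_n))$ mapping integral curves of the first system to integral curves of the second, that is, such that $\Phi^*(dX_i-F_i\,dT)=\sum_{j=1}^n a_{ij}(dx_j-f_j\,dt)$ for $i=1,\dots,n$ with some smooth $\mathrm{GL}(n,\mathbb{R})$-valued function $[a_{ij}]$. The $\{e\}$-equivalence problem with coframe $\theta=(\theta^0,\dots,\theta^n)$ is the equivalence problem for coframes with trivial structure group: the diffeomorphisms $\Phi$ considered are those with $\Phi^*\Theta^k=\theta^k$ for $k=0,\dots,n$, where $\Theta$ is the coframe constructed in the same way from the second system.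
   Formalization: The coframe is corrected to θ⁰=ℓ₁₂dt, θⁱ=ℓ₁₂dx_i/f_i, and ∂ℓ₁₂/∂x_j in the structure equations to (f_j/ℓ₁₂²)∂ℓ₁₂/∂x_j, as the printed ones are false; web form of Φ is required near each point, and globally when the coordinate slices of U are connected. *)

theory Defs
  imports "HOL-Analysis.Analysis"
begin

section \<open>Smooth maps\<close>

primrec Ck_on :: "nat \<Rightarrow> ('a::real_normed_vector \<Rightarrow> 'b::real_normed_vector) \<Rightarrow> 'a set \<Rightarrow> bool" where
  "Ck_on 0 f S \<longleftrightarrow> continuous_on S f"
| "Ck_on (Suc k) f S \<longleftrightarrow>
     (\<forall>x\<in>S. f differentiable (at x)) \<and>
     (\<forall>v. Ck_on k (\<lambda>x. frechet_derivative f (at x) v) S)"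

text \<open>Only used on open sets \<open>S\<close> of finite-dimensional spaces.\<close>

definition smooth_on :: "'a set \<Rightarrow> ('a::real_normed_vector \<Rightarrow> 'b::real_normed_vector) \<Rightarrow> bool" where
  "smooth_on S f \<longleftrightarrow> (\<forall>k. Ck_on k f S)"

definition diffeomorphism_on :: "'a set \<Rightarrow> 'b set \<Rightarrow>
    ('a::real_normed_vector \<Rightarrow> 'b::real_normed_vector) \<Rightarrow> bool" where
  "diffeomorphism_on U V \<Phi> \<longleftrightarrow>
     bij_betw \<Phi> U V \<and> smooth_on U \<Phi> \<and> smooth_on V (inv_into U \<Phi>)"

definition partial :: "'n \<Rightarrow> (real^'n \<Rightarrow> real) \<Rightarrow> real^'n \<Rightarrow> real" where
  "partial j g x = frechet_derivative g (at x) (axis j 1)"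

section \<open>Differential forms\<close>

text \<open>A form is given by its values: first argument the base point, then the tangent vectors.\<close>

type_synonym 'a form1 = "'a \<Rightarrow> 'a \<Rightarrow> real"
type_synonym 'a form2 = "'a \<Rightarrow> 'a \<Rightarrow> 'a \<Rightarrow> real"

definition differential :: "('a::real_normed_vector \<Rightarrow> real) \<Rightarrow> 'a form1" where
  "differential g p v = frechet_derivative g (at p) v"

text \<open>Wedge product and exterior derivative are normalised so that
  \<open>d (g dh) = dg \<and> dh\<close>, without factors 1/2. In \<open>ext_deriv\<close> the vectors \<open>u\<close>, \<open>v\<close>
  are constant vector fields, so the bracket term of the invariant formula vanishes.\<close>

definition wedge :: "'a form1 \<Rightarrow> 'a form1 \<Rightarrow> 'a form2" where
  "wedge \<alpha> \<beta> p u v = \<alpha> p u * \<beta> p v - \<alpha> p v * \<beta> p u"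

definition ext_deriv :: "('a::real_normed_vector) form1 \<Rightarrow> 'a form2" where
  "ext_deriv \<omega> p u v =
     frechet_derivative (\<lambda>q. \<omega> q v) (at p) u - frechet_derivative (\<lambda>q. \<omega> q u) (at p) v"

definition pullback :: "('a::real_normed_vector \<Rightarrow> 'b::real_normed_vector) \<Rightarrow> 'b form1 \<Rightarrow> 'a form1" where
  "pullback \<Phi> \<omega> p v = \<omega> (\<Phi> p) (frechet_derivative \<Phi> (at p) v)"

definition coframe_on :: "'a set \<Rightarrow> ('k::finite \<Rightarrow> ('a::euclidean_space) form1) \<Rightarrow> bool" where
  "coframe_on U \<theta> \<longleftrightarrow>
     CARD('k) = DIM('a) \<and>
     (\<forall>k. \<forall>p\<in>U. linear (\<theta> k p)) \<and>
     (\<forall>k v. smooth_on U (\<lambda>p. \<theta> k p v)) \<and>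
     (\<forall>p\<in>U. \<forall>c. (\<forall>v. (\<Sum>k\<in>UNIV. c k * \<theta> k p v) = 0) \<longrightarrow> (\<forall>k. c k = 0))"

text \<open>Equivalences for the trivial structure group.\<close>

definition e_equivalence :: "'a set \<Rightarrow> ('k \<Rightarrow> ('a::real_normed_vector) form1) \<Rightarrow>
    'b set \<Rightarrow> ('k \<Rightarrow> ('b::real_normed_vector) form1) \<Rightarrow> ('a \<Rightarrow> 'b) \<Rightarrow> bool" where
  "e_equivalence U \<theta> V \<Theta> \<Phi> \<longleftrightarrow>
     diffeomorphism_on U V \<Phi> \<and>
     (\<forall>k. \<forall>p\<in>U. \<forall>v. pullback \<Phi> (\<Theta> k) p v = \<theta> k p v)"

section \<open>Web geometry of autonomous systems\<close>

text \<open>Points of \<open>\<real>\<^sup>n\<^sup>+\<^sup>1\<close> are pairs \<open>(t, x)\<close>. The right-hand side of a system on \<open>U\<close> is a function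
  of \<open>x\<close> alone, defined on the projection \<open>snd ` U\<close>.\<close>

abbreviation dt :: "(real \<times> (real^'n)) form1" where
  "dt \<equiv> differential fst"

abbreviation dx :: "'n \<Rightarrow> (real \<times> (real^'n)) form1" where
  "dx i \<equiv> differential (\<lambda>p. snd p $ i)"

definition ell :: "(real^'n \<Rightarrow> real^'n) \<Rightarrow> 'n \<Rightarrow> 'n \<Rightarrow> real^'n \<Rightarrow> real" where
  "ell f i j x = f x $ j * partial j (\<lambda>y. ln \<bar>f y $ i\<bar>) x"

text \<open>The two distinct indices \<open>a\<close>, \<open>b\<close> play the roles of 1 and 2.\<close>

definition regular_system :: "'n \<Rightarrow> 'n \<Rightarrow> (real \<times> (real^'n)) set \<Rightarrow> (real^'n \<Rightarrow> real^'n) \<Rightarrow> bool" where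
  "regular_system a b U f \<longleftrightarrow>
     open U \<and> smooth_on (snd ` U) f \<and>
     (\<forall>x\<in>snd ` U. (\<forall>i. f x $ i \<noteq> 0) \<and> ell f a b x \<noteq> 0)"

definition web_form :: "(real \<times> (real^'n)) set \<Rightarrow> (real \<times> (real^'n) \<Rightarrow> real \<times> (real^'n)) \<Rightarrow> bool" where
  "web_form U \<Phi> \<longleftrightarrow>
     (\<exists>\<phi>0 \<phi>. \<forall>t x. (t, x) \<in> U \<longrightarrow> \<Phi> (t, x) = (\<phi>0 t, (\<chi> i. \<phi> i (x $ i))))"

text \<open>Membership in the pseudo-group is a local condition. If some coordinate slice of \<open>U\<close> is
  disconnected, a map that is of web form near every point need not be of web form on \<open>U\<close>.\<close>

definition locally_web_form :: "(real \<times> (real^'n)) set \<Rightarrow> (real \<times> (real^'n) \<Rightarrow> real \<times> (real^'n)) \<Rightarrow> bool" where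
  "locally_web_form U \<Phi> \<longleftrightarrow> (\<forall>p\<in>U. \<exists>N. open N \<and> p \<in> N \<and> N \<subseteq> U \<and> web_form N \<Phi>)"

definition connected_slices :: "(real \<times> (real^'n)) set \<Rightarrow> bool" where
  "connected_slices U \<longleftrightarrow>
     (\<forall>c. connected {p \<in> U. fst p = c}) \<and> (\<forall>i c. connected {p \<in> U. snd p $ i = c})"

definition maps_integral_curves :: "(real \<times> (real^'n)) set \<Rightarrow> (real^'n \<Rightarrow> real^'n) \<Rightarrow>
    (real^'n \<Rightarrow> real^'n) \<Rightarrow> (real \<times> (real^'n) \<Rightarrow> real \<times> (real^'n)) \<Rightarrow> bool" where
  "maps_integral_curves U f F \<Phi> \<longleftrightarrow>
     (\<exists>a :: real \<times> (real^'n) \<Rightarrow> real^'n^'n.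
        smooth_on U a \<and> (\<forall>p\<in>U. invertible (a p)) \<and>
        (\<forall>i. \<forall>p\<in>U. \<forall>v.
           pullback \<Phi> (\<lambda>q w. dx i q w - F (snd q) $ i * dt q w) p v =
           (\<Sum>j\<in>UNIV. a p $ i $ j * (dx j p v - f (snd p) $ j * dt p v))))"

definition web_equivalence :: "(real \<times> (real^'n)) set \<Rightarrow> (real^'n \<Rightarrow> real^'n) \<Rightarrow>
    (real \<times> (real^'n)) set \<Rightarrow> (real^'n \<Rightarrow> real^'n) \<Rightarrow> (real \<times> (real^'n) \<Rightarrow> real \<times> (real^'n)) \<Rightarrow> bool" where
  "web_equivalence U f V F \<Phi> \<longleftrightarrow>
     diffeomorphism_on U V \<Phi> \<and> web_form U \<Phi> \<and> maps_integral_curves U f F \<Phi>"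

definition local_web_equivalence :: "(real \<times> (real^'n)) set \<Rightarrow> (real^'n \<Rightarrow> real^'n) \<Rightarrow>
    (real \<times> (real^'n)) set \<Rightarrow> (real^'n \<Rightarrow> real^'n) \<Rightarrow> (real \<times> (real^'n) \<Rightarrow> real \<times> (real^'n)) \<Rightarrow> bool" where
  "local_web_equivalence U f V F \<Phi> \<longleftrightarrow>
     diffeomorphism_on U V \<Phi> \<and> locally_web_form U \<Phi> \<and> maps_integral_curves U f F \<Phi>"

text \<open>A web equivalence has \<open>dT = c dt\<close> with \<open>c\<close> locally constant, and it carries \<open>ell F\<close> to
  \<open>ell f / c\<close> and \<open>dX\<^sub>i / F\<^sub>i\<close> to \<open>c dx\<^sub>i / f\<^sub>i\<close>. Hence \<open>dt\<close> and \<open>dx\<^sub>i / f\<^sub>i\<close> have to be multiplied by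
  \<open>ell f a b\<close> to become invariant. In print the coframe appears as \<open>dt\<close>, \<open>dx\<^sub>i / (ell f a b f\<^sub>i)\<close>;
  that one is not invariant, and its closed first member contradicts the formula printed for
  \<open>d\<theta>\<^sup>0\<close>. Index \<open>None\<close> stands for 0.\<close>

fun web_coframe :: "'n \<Rightarrow> 'n \<Rightarrow> (real^'n \<Rightarrow> real^'n) \<Rightarrow> 'n option \<Rightarrow> (real \<times> (real^'n)) form1" where
  "web_coframe a b f None p v = ell f a b (snd p) * dt p v"
| "web_coframe a b f (Some i) p v = ell f a b (snd p) / f (snd p) $ i * dx i p v"

text \<open>The coefficient of \<open>\<theta>\<^sup>j\<close> in \<open>d (ln |ell f a b|)\<close>, i.e. the derivative along the frame dual to
  \<open>web_coframe a b f\<close>. It replaces the coordinate derivative of \<open>ell f a b\<close> that is printed in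
  the structure equations.\<close>

definition dlog_ell :: "'n \<Rightarrow> 'n \<Rightarrow> (real^'n \<Rightarrow> real^'n) \<Rightarrow> 'n \<Rightarrow> real^'n \<Rightarrow> real" where
  "dlog_ell a b f j x = f x $ j / (ell f a b x)\<^sup>2 * partial j (ell f a b) x"

end

theory Submission
  imports Defs
begin

text \<open>Write \<open>\<ell> = ell f a b\<close>. Since \<open>\<theta>\<^sup>0 = \<ell> dt\<close> and \<open>\<theta>\<^sup>i = (\<ell> / f\<^sub>i) dx\<^sub>i\<close> are function multiples of
  closed forms, their exterior derivatives are wedges of \<open>\<theta>\<^sup>0\<close>, \<open>\<theta>\<^sup>i\<close> with the logarithmic derivatives of
  \<open>\<ell>\<close> and \<open>\<ell> / f\<^sub>i\<close>. Expanding these in the coframe gives the structure equations: the coefficient of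
  \<open>\<theta>\<^sup>j\<close> in \<open>d ln |f\<^sub>i|\<close> is \<open>ell f i j / \<ell>\<close>, and the coefficient in \<open>d ln |\<ell>|\<close> is \<open>dlog_ell a b f j\<close>.

  For the equivalence problems, both kinds of map \<open>\<Phi>\<close> have a derivative that is diagonal in the
  coordinates \<open>(t, x\<^sub>1, \<dots>, x\<^sub>n)\<close>. Let \<open>A\<close> and \<open>B\<^sub>i\<close> be its diagonal entries. A diagonal \<open>\<Phi>\<close> carries
  integral curves to integral curves iff \<open>A F\<^sub>i(\<Phi>) = B\<^sub>i f\<^sub>i\<close> with all \<open>B\<^sub>i \<noteq> 0\<close>
  (\<open>maps_integral_curves_iff\<close>), and it preserves the coframe iff in addition \<open>A ell F a b(\<Phi>) = \<ell>\<close>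
  (\<open>preserves_web_coframe_iff\<close>). So two points remain.

  The additional equation is automatic for web transformations (\<open>ell_transform\<close>). Along the
  coordinate line of \<open>x\<^sub>b\<close>, the entry \<open>A\<close> depends on \<open>t\<close> only and \<open>B\<^sub>a\<close> on \<open>x\<^sub>a\<close> only, so both are
  constant because \<open>a \<noteq> b\<close>, and \<open>ln |F\<^sub>a(\<Phi>)|\<close> differs from \<open>ln |f\<^sub>a|\<close> by a constant. Differentiating
  gives \<open>B\<^sub>b (\<partial>\<^sub>b ln |F\<^sub>a|)(\<Phi>) = \<partial>\<^sub>b ln |f\<^sub>a|\<close>; multiplication by \<open>f\<^sub>b\<close> and \<open>B\<^sub>b f\<^sub>b = A F\<^sub>b(\<Phi>)\<close> finish.

  Conversely, a map with diagonal derivative is of web form, because a component whose derivative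
  vanishes along a coordinate slice is constant on the slice if the slice is connected
  (\<open>web_form_if_diagonal_on\<close>). Slices of balls are connected, which gives the local statement; the
  hypothesis \<open>connected_slices U\<close> gives the global one.\<close>

section \<open>Closure properties of smooth maps\<close>

lemma Ck_on_cong:
  assumes "open S" "\<And>x. x \<in> S \<Longrightarrow> f x = g x" "Ck_on k f S"
  shows "Ck_on k g S"
  using assms(2,3)
proof (induction k arbitrary: f g)
  case 0
  then show ?case using continuous_on_cong[of S S f g] by simp
next
  case (Suc k)
  have d: "f differentiable at x" if "x \<in> S" for x using Suc.prems(2) that by simp
  have e: "frechet_derivative f (at x) = frechet_derivative g (at x)" if "x \<in> S" for x
    using frechet_derivative_transform_within_open[OF d[OF that] assms(1) that] Suc.prems(1) by blast
  have "g differentiable at x" if "x \<in> S" for x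
    using d[OF that] has_derivative_transform_within_open[OF _ assms(1) that, of f _ UNIV g] Suc.prems(1)
    unfolding differentiable_def by blast
  moreover have "Ck_on k (\<lambda>x. frechet_derivative g (at x) v) S" for v
    by (rule Suc.IH[of "\<lambda>x. frechet_derivative f (at x) v"]) (use Suc.prems e in auto)
  ultimately show ?case by simp
qed

text \<open>Replaces \<open>frechet_derivative\<close> by any explicitly computed derivative, so that the
  closure properties below follow by induction from the differentiation rules.\<close>

lemma Ck_on_SucI:
  assumes "open S" "\<And>x. x \<in> S \<Longrightarrow> (f has_derivative f' x) (at x)"
    and "\<And>v. Ck_on k (\<lambda>x. f' x v) S"
  shows "Ck_on (Suc k) f S"
proof -
  have "Ck_on k (\<lambda>x. frechet_derivative f (at x) v) S" for v
    by (rule Ck_on_cong[OF assms(1) _ assms(3)[of v]]) (simp add: frechet_derivative_at[OF assms(2), symmetric])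
  then show ?thesis using assms(2) by (auto simp: differentiable_def)
qed

lemma Ck_on_Suc_has_derivative:
  assumes "Ck_on (Suc k) f S" "x \<in> S"
  shows "(f has_derivative frechet_derivative f (at x)) (at x)"
  using assms frechet_derivative_works by auto

lemma Ck_on_SucD: "Ck_on (Suc k) f S \<Longrightarrow> Ck_on k f S"
proof (induction k arbitrary: f)
  case 0
  then show ?case
    by (auto intro!: continuous_at_imp_continuous_on differentiable_imp_continuous_within)
next
  case (Suc k)
  then show ?case by (metis Ck_on.simps(2))
qed

lemma Ck_on_const: "Ck_on k (\<lambda>x. c) S"
  by (induction k arbitrary: c) auto

lemma Ck_on_linear_left:
  assumes "open S" "bounded_linear L" "Ck_on k f S"
  shows "Ck_on k (\<lambda>x. L (f x)) S"
  using assms(3)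
proof (induction k arbitrary: f)
  case 0
  then show ?case using bounded_linear.continuous_on[OF assms(2)] by auto
next
  case (Suc k)
  show ?case
    by (rule Ck_on_SucI[OF assms(1),
          OF bounded_linear.has_derivative[OF assms(2) Ck_on_Suc_has_derivative[OF Suc.prems]]])
      (use Suc in auto)
qed

lemma Ck_on_linear_right:
  assumes "open S" "bounded_linear L" "L ` S \<subseteq> T" "Ck_on k f T"
  shows "Ck_on k (\<lambda>x. f (L x)) S"
  using assms(4)
proof (induction k arbitrary: f)
  case 0
  have "continuous_on S L" using bounded_linear.continuous_on[OF assms(2) continuous_on_id] by simp
  then show ?case using continuous_on_compose2[of T f S L] 0 assms(3) by auto
next
  case (Suc k)
  have "((\<lambda>x. f (L x)) has_derivative (\<lambda>v. frechet_derivative f (at (L x)) (L v))) (at x)"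
    if "x \<in> S" for x
    using diff_chain_at[OF bounded_linear.has_derivative[OF assms(2) has_derivative_ident]
        Ck_on_Suc_has_derivative[OF Suc.prems, of "L x"]] that assms(3) by (auto simp: o_def)
  then show ?case
    by (rule Ck_on_SucI[OF assms(1)]) (use Suc in auto)
qed

lemma Ck_on_add:
  assumes "open S" "Ck_on k f S" "Ck_on k g S"
  shows "Ck_on k (\<lambda>x. f x + g x) S"
  using assms(2,3)
proof (induction k arbitrary: f g)
  case 0
  then show ?case by (auto intro: continuous_on_add)
next
  case (Suc k)
  show ?case
    by (rule Ck_on_SucI[OF assms(1),
          OF has_derivative_add[OF Ck_on_Suc_has_derivative[OF Suc.prems(1)]
              Ck_on_Suc_has_derivative[OF Suc.prems(2)]]])
      (use Suc in auto)
qed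

lemma Ck_on_mult:
  fixes f g :: "'a::real_normed_vector \<Rightarrow> real"
  assumes "open S" "Ck_on k f S" "Ck_on k g S"
  shows "Ck_on k (\<lambda>x. f x * g x) S"
  using assms(2,3)
proof (induction k arbitrary: f g)
  case 0
  then show ?case by (auto intro: continuous_on_mult)
next
  case (Suc k)
  show ?case
    by (rule Ck_on_SucI[OF assms(1),
          OF has_derivative_mult[OF Ck_on_Suc_has_derivative[OF Suc.prems(1)]
              Ck_on_Suc_has_derivative[OF Suc.prems(2)]]])
      (use Suc Suc.prems[THEN Ck_on_SucD] in \<open>auto intro!: Ck_on_add[OF assms(1)]\<close>)
qed

lemma Ck_on_inverse:
  fixes f :: "'a::real_normed_vector \<Rightarrow> real"
  assumes "open S" "Ck_on k f S" "\<And>x. x \<in> S \<Longrightarrow> f x \<noteq> 0"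
  shows "Ck_on k (\<lambda>x. inverse (f x)) S"
  using assms(2)
proof (induction k)
  case 0
  then show ?case using assms(3) by (auto intro: continuous_on_inverse)
next
  case (Suc k)
  have inv: "Ck_on k (\<lambda>x. inverse (f x)) S" using Suc Ck_on_SucD by blast
  have "((\<lambda>x. inverse (f x)) has_derivative
      (\<lambda>v. (-1) * (inverse (f x) * frechet_derivative f (at x) v * inverse (f x)))) (at x)"
    if "x \<in> S" for x
    using Deriv.has_derivative_inverse[OF assms(3)[OF that] Ck_on_Suc_has_derivative[OF Suc.prems that]]
    by simp
  moreover have "Ck_on k (\<lambda>x. (-1) * (inverse (f x) * frechet_derivative f (at x) v * inverse (f x))) S"
    for v
    using Suc.prems by (intro Ck_on_mult assms(1) Ck_on_const inv) simp
  ultimately show ?case by (rule Ck_on_SucI[OF assms(1)])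
qed

lemma smooth_on_cong:
  "open S \<Longrightarrow> (\<And>x. x \<in> S \<Longrightarrow> f x = g x) \<Longrightarrow> smooth_on S f \<Longrightarrow> smooth_on S g"
  unfolding smooth_on_def using Ck_on_cong by metis

lemma smooth_on_const: "smooth_on S (\<lambda>x. c)"
  by (simp add: smooth_on_def Ck_on_const)

lemma smooth_on_linear_left:
  "open S \<Longrightarrow> bounded_linear L \<Longrightarrow> smooth_on S f \<Longrightarrow> smooth_on S (\<lambda>x. L (f x))"
  by (simp add: smooth_on_def Ck_on_linear_left)

lemma smooth_on_linear_right:
  "open S \<Longrightarrow> bounded_linear L \<Longrightarrow> L ` S \<subseteq> T \<Longrightarrow> smooth_on T f \<Longrightarrow> smooth_on S (\<lambda>x. f (L x))"
  by (simp add: smooth_on_def Ck_on_linear_right[of S L T])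

lemma smooth_on_mult:
  fixes f g :: "'a::real_normed_vector \<Rightarrow> real"
  shows "open S \<Longrightarrow> smooth_on S f \<Longrightarrow> smooth_on S g \<Longrightarrow> smooth_on S (\<lambda>x. f x * g x)"
  by (simp add: smooth_on_def Ck_on_mult)

lemma smooth_on_divide:
  fixes f g :: "'a::real_normed_vector \<Rightarrow> real"
  assumes "open S" "smooth_on S f" "smooth_on S g" "\<And>x. x \<in> S \<Longrightarrow> g x \<noteq> 0"
  shows "smooth_on S (\<lambda>x. f x / g x)"
  using assms unfolding divide_inverse smooth_on_def by (simp add: Ck_on_mult Ck_on_inverse)

lemma smooth_on_sum:
  assumes "open S" "finite I" "\<And>i. i \<in> I \<Longrightarrow> smooth_on S (f i)"
  shows "smooth_on S (\<lambda>x. \<Sum>i\<in>I. f i x)"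
  using assms(2,3)
proof (induction I)
  case empty
  then show ?case by (simp add: smooth_on_const)
next
  case (insert i I)
  then show ?case by (simp add: smooth_on_def Ck_on_add[OF assms(1)])
qed

lemma smooth_on_has_derivative:
  "smooth_on S f \<Longrightarrow> x \<in> S \<Longrightarrow> (f has_derivative frechet_derivative f (at x)) (at x)"
  unfolding smooth_on_def by (rule Ck_on_Suc_has_derivative[of 0]) simp_all

lemma smooth_on_frechet_derivative:
  "smooth_on S f \<Longrightarrow> smooth_on S (\<lambda>x. frechet_derivative f (at x) v)"
  unfolding smooth_on_def
proof
  fix k assume "\<forall>k. Ck_on k f S"
  then have "Ck_on (Suc k) f S" by blast
  then show "Ck_on k (\<lambda>x. frechet_derivative f (at x) v) S" by simp
qed

section \<open>The functions \<open>ell\<close> and the structure equations\<close>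

lemma has_derivative_ln_abs:
  fixes g :: "'a::real_normed_vector \<Rightarrow> real"
  assumes "(g has_derivative g') (at x)" "g x \<noteq> 0"
  shows "((\<lambda>y. ln \<bar>g y\<bar>) has_derivative (\<lambda>v. g' v / g x)) (at x)"
proof -
  have "(ln has_real_derivative 1 / z) (at z)" if "z \<noteq> 0" for z :: real
  proof (cases "z > 0")
    case False
    then have "((\<lambda>y. ln (- y)) has_real_derivative 1 / z) (at z)"
      using that by (auto intro!: derivative_eq_intros)
    then show ?thesis by (simp add: ln_minus)
  qed (rule DERIV_ln_divide)
  moreover have "ln \<bar>z\<bar> = ln z" for z :: real by (simp add: abs_if ln_minus)
  ultimately show ?thesis
    using DERIV_compose_FDERIV[OF _ assms(1), of ln "1 / g x"] assms(2) by (simp)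
qed

lemma frechet_derivative_eq_sum_partial:
  fixes g :: "real^'n \<Rightarrow> real"
  assumes "g differentiable (at x)"
  shows "frechet_derivative g (at x) v = (\<Sum>j\<in>UNIV. v $ j * partial j g x)"
proof -
  interpret linear "frechet_derivative g (at x)" by (rule linear_frechet_derivative[OF assms])
  have "frechet_derivative g (at x) v = frechet_derivative g (at x) (\<Sum>j\<in>UNIV. v $ j *\<^sub>R axis j 1)"
    by (simp only: scalar_mult_eq_scaleR[symmetric] basis_expansion)
  then show ?thesis by (simp add: sum scale partial_def)
qed

lemma dt_apply: "dt q w = fst w"
  unfolding differential_def
  by (subst frechet_derivative_at[OF has_derivative_fst[OF has_derivative_ident], symmetric]) (rule refl)

lemma dx_apply: "dx i q w = snd w $ i"
proof -
  have "((\<lambda>p. snd p $ i) has_derivative (\<lambda>w. snd w $ i)) (at q)"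
    by (intro bounded_linear_imp_has_derivative bounded_linear_compose[OF bounded_linear_vec_nth bounded_linear_snd])
  from frechet_derivative_at[OF this, symmetric] show ?thesis by (simp add: differential_def)
qed

lemma regular_system_smooth_component:
  assumes "regular_system a b U f"
  shows "smooth_on (snd ` U) (\<lambda>x. f x $ i)"
  using assms by (auto simp: regular_system_def
      intro: smooth_on_linear_left[OF open_image_snd bounded_linear_vec_nth])

lemma regular_system_ln_has_derivative:
  assumes "regular_system a b U f" "x \<in> snd ` U"
  shows "((\<lambda>y. ln \<bar>f y $ i\<bar>) has_derivative
      (\<lambda>v. frechet_derivative (\<lambda>y. f y $ i) (at x) v / f x $ i)) (at x)"
proof -
  have "f x $ i \<noteq> 0" using assms by (auto simp: regular_system_def)
  then show ?thesis
    by (rule has_derivative_ln_abs[OF smooth_on_has_derivative[OF regular_system_smooth_component[OF assms(1)] assms(2)]])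
qed

lemma regular_system_ell:
  assumes "regular_system a b U f" "x \<in> snd ` U"
  shows "ell f i j x = f x $ j * (partial j (\<lambda>y. f y $ i) x / f x $ i)"
  unfolding ell_def partial_def
  by (simp only: frechet_derivative_at[OF regular_system_ln_has_derivative[OF assms], symmetric])

lemma smooth_on_ell:
  assumes "regular_system a b U f"
  shows "smooth_on (snd ` U) (ell f i j)"
proof -
  have o: "open (snd ` U)" using assms open_image_snd by (auto simp: regular_system_def)
  note c = regular_system_smooth_component[OF assms]
  have "smooth_on (snd ` U) (\<lambda>x. f x $ j * (partial j (\<lambda>y. f y $ i) x / f x $ i))"
    unfolding partial_def
    by (intro smooth_on_mult smooth_on_divide c o smooth_on_frechet_derivative)
      (use assms in \<open>auto simp: regular_system_def\<close>)
  then show ?thesis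
    by (rule smooth_on_cong[OF o, rotated]) (simp add: regular_system_ell[OF assms])
qed

lemma coframe_on_web_coframe:
  fixes f :: "real^'n \<Rightarrow> real^'n"
  assumes "regular_system a b U f"
  shows "coframe_on U (web_coframe a b f)"
proof -
  have oU: "open U" and o: "open (snd ` U)"
    and nz: "\<And>p i. p \<in> U \<Longrightarrow> f (snd p) $ i \<noteq> 0" "\<And>p. p \<in> U \<Longrightarrow> ell f a b (snd p) \<noteq> 0"
    using assms open_image_snd by (auto simp: regular_system_def)
  note c = regular_system_smooth_component[OF assms] and e = smooth_on_ell[OF assms]
  have lin: "linear (web_coframe a b f k p)" for k p
    by (cases k) (auto intro!: linearI simp: dt_apply dx_apply algebra_simps add_divide_distrib)
  have sm: "smooth_on U (\<lambda>p. web_coframe a b f k p v)" for k v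
  proof (cases k)
    case None
    have "smooth_on U (\<lambda>p. ell f a b (snd p) * fst v)"
      by (intro smooth_on_mult oU smooth_on_const smooth_on_linear_right[OF oU bounded_linear_snd order_refl e])
    then show ?thesis by (simp add: None dt_apply)
  next
    case (Some i)
    have "smooth_on U (\<lambda>p. ell f a b (snd p) / f (snd p) $ i * (snd v $ i))"
      by (intro smooth_on_mult smooth_on_divide oU smooth_on_const nz
        smooth_on_linear_right[OF oU bounded_linear_snd order_refl e]
        smooth_on_linear_right[OF oU bounded_linear_snd order_refl c])
    then show ?thesis by (simp add: Some dx_apply)
  qed
  have ind: "c k = 0" if p: "p \<in> U" and z: "\<And>v. (\<Sum>k\<in>UNIV. c k * web_coframe a b f k p v) = 0" for p c k
  proof -
    have s: "c None * (ell f a b (snd p) * fst v)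
        + (\<Sum>i\<in>UNIV. c (Some i) * (ell f a b (snd p) / f (snd p) $ i * snd v $ i)) = 0" for v
      using z[of v] by (simp add: UNIV_option_conv sum.reindex dt_apply dx_apply)
    show ?thesis
    proof (cases k)
      case None
      then show ?thesis using s[of "(1, 0)"] nz[OF p] by simp
    next
      case (Some i)
      have "(\<Sum>j\<in>UNIV. c (Some j) * (ell f a b (snd p) / f (snd p) $ j * axis i 1 $ j))
        = (\<Sum>j\<in>UNIV. if j = i then c (Some j) * (ell f a b (snd p) / f (snd p) $ j) else 0)"
        by (rule sum.cong) (auto simp: axis_def)
      then show ?thesis using s[of "(0, axis i 1)"] nz[OF p] Some by simp
    qed
  qed
  have card: "CARD('n option) = DIM(real \<times> (real^'n))" by simp
  show ?thesis unfolding coframe_on_def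
    by (intro conjI allI ballI impI lin sm card) (rule ind, assumption, erule spec)
qed

lemma ext_deriv_web_coframe_None:
  fixes f :: "real^'n \<Rightarrow> real^'n"
  assumes "regular_system a b U f" "p \<in> U"
  shows "ext_deriv (web_coframe a b f None) p u v =
     - (\<Sum>i\<in>UNIV. dlog_ell a b f i (snd p)
          * wedge (web_coframe a b f None) (web_coframe a b f (Some i)) p u v)"
proof -
  let ?l = "ell f a b"
  define x where "x = snd p"
  have x: "x \<in> snd ` U" and nz: "\<And>i. f x $ i \<noteq> 0" "?l x \<noteq> 0"
    using assms by (auto simp: regular_system_def x_def)
  have D: "(?l has_derivative frechet_derivative ?l (at x)) (at x)"
    using smooth_on_has_derivative[OF smooth_on_ell] assms x by blast
  have "((\<lambda>q. ?l (snd q) * fst w) has_derivative (\<lambda>v. frechet_derivative ?l (at x) (snd v) * fst w)) (at p)"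
    for w :: "real \<times> (real^'n)"
    by (rule has_derivative_mult_left, rule has_derivative_compose[OF has_derivative_snd[OF has_derivative_ident]])
      (use D x_def in simp)
  note deriv = this
  have "ext_deriv (web_coframe a b f None) p u v
      = frechet_derivative ?l (at x) (snd u) * fst v - frechet_derivative ?l (at x) (snd v) * fst u"
    unfolding ext_deriv_def web_coframe.simps dt_apply
    by (simp only: frechet_derivative_at[OF deriv, symmetric])
  also have "\<dots> = (\<Sum>i\<in>UNIV. partial i ?l x * (snd u $ i * fst v - snd v $ i * fst u))"
    using frechet_derivative_eq_sum_partial[OF differentiableI[OF D]]
    by (simp add: sum_distrib_right sum_distrib_left sum_subtractf algebra_simps)
  also have "\<dots> = - (\<Sum>i\<in>UNIV. dlog_ell a b f i x
          * wedge (web_coframe a b f None) (web_coframe a b f (Some i)) p u v)"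
    unfolding sum_negf[symmetric] using nz
    by (intro sum.cong refl)
      (simp add: wedge_def dlog_ell_def dt_apply dx_apply flip: x_def, simp add: field_simps power2_eq_square)
  finally show ?thesis by (simp add: x_def)
qed

lemma ext_deriv_web_coframe_Some:
  fixes f :: "real^'n \<Rightarrow> real^'n"
  assumes "regular_system a b U f" "p \<in> U"
  shows "ext_deriv (web_coframe a b f (Some i)) p u v =
     (\<Sum>j\<in>UNIV. (ell f i j (snd p) / ell f a b (snd p) - dlog_ell a b f j (snd p))
          * wedge (web_coframe a b f (Some i)) (web_coframe a b f (Some j)) p u v)"
proof -
  let ?l = "ell f a b" and ?g = "\<lambda>y. f y $ i"
  define x where "x = snd p"
  have x: "x \<in> snd ` U" and nz: "\<And>i. f x $ i \<noteq> 0" "?l x \<noteq> 0"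
    using assms by (auto simp: regular_system_def x_def)
  have D: "(?l has_derivative frechet_derivative ?l (at x)) (at x)"
    using smooth_on_has_derivative[OF smooth_on_ell] assms x by blast
  have G: "(?g has_derivative frechet_derivative ?g (at x)) (at x)"
    using smooth_on_has_derivative[OF regular_system_smooth_component] assms x by blast
  define h where "h v = (frechet_derivative ?l (at x) v * ?g x - ?l x * frechet_derivative ?g (at x) v)
      / (?g x)\<^sup>2" for v
  have "((\<lambda>y. ?l y / ?g y) has_derivative h) (at x)"
    using has_derivative_divide'[OF D G] nz by (simp add: h_def[abs_def] power2_eq_square)
  then have "((\<lambda>q. ?l (snd q) / ?g (snd q)) has_derivative (\<lambda>v. h (snd v))) (at p)"
    using has_derivative_compose[OF has_derivative_snd[OF has_derivative_ident], where g = "\<lambda>y. ?l y / ?g y"]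
    by (simp add: x_def)
  then have "((\<lambda>q. ?l (snd q) / ?g (snd q) * snd w $ i) has_derivative (\<lambda>v. h (snd v) * snd w $ i)) (at p)"
    for w :: "real \<times> (real^'n)"
    by (rule has_derivative_mult_left)
  note deriv = this
  have ext: "ext_deriv (web_coframe a b f (Some i)) p u v = h (snd u) * snd v $ i - h (snd v) * snd u $ i"
    unfolding ext_deriv_def web_coframe.simps dx_apply
    by (simp only: frechet_derivative_at[OF deriv, symmetric])
  have h_sum: "h w = (\<Sum>j\<in>UNIV. (partial j ?l x * ?g x - ?l x * partial j ?g x) / (?g x)\<^sup>2 * w $ j)" for w
    unfolding h_def frechet_derivative_eq_sum_partial[OF differentiableI[OF D]]
      frechet_derivative_eq_sum_partial[OF differentiableI[OF G]]
      sum_distrib_right sum_distrib_left sum_subtractf[symmetric] sum_divide_distrib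
    by (intro sum.cong refl) (simp add: algebra_simps)
  have "ext_deriv (web_coframe a b f (Some i)) p u v = (\<Sum>j\<in>UNIV.
      (partial j ?l x * ?g x - ?l x * partial j ?g x) / (?g x)\<^sup>2 * (snd u $ j * snd v $ i - snd v $ j * snd u $ i))"
    unfolding ext h_sum sum_distrib_right sum_subtractf[symmetric]
    by (intro sum.cong refl) (simp only: algebra_simps)
  also have "\<dots> = (\<Sum>j\<in>UNIV. (ell f i j x / ell f a b x - dlog_ell a b f j x)
          * wedge (web_coframe a b f (Some i)) (web_coframe a b f (Some j)) p u v)"
  proof (intro sum.cong refl)
    fix j
    have e: "ell f i j x = f x $ j * (partial j ?g x / f x $ i)"
      using regular_system_ell[OF assms(1) x] .
    show "(partial j ?l x * ?g x - ?l x * partial j ?g x) / (?g x)\<^sup>2 * (snd u $ j * snd v $ i - snd v $ j * snd u $ i)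
      = (ell f i j x / ell f a b x - dlog_ell a b f j x)
          * wedge (web_coframe a b f (Some i)) (web_coframe a b f (Some j)) p u v"
      unfolding e wedge_def dlog_ell_def web_coframe.simps dx_apply x_def[symmetric]
      using nz(2) nz(1)[of i] nz(1)[of j] by (simp add: field_simps power2_eq_square)
  qed
  finally show ?thesis by (simp add: x_def)
qed

section \<open>Maps factoring through a coordinate\<close>

text \<open>Both curves \<open>q + s w\<close> and \<open>q' + s w'\<close> have the same image under \<open>L\<close>, so \<open>g\<close> agrees along
  them for small \<open>s\<close>. With \<open>q = q'\<close> this says that the
  derivative factors through \<open>L\<close>, with \<open>w = w'\<close> that it is constant on the fibres of \<open>L\<close>.\<close>

lemma derivative_eq_if_factors:
  fixes L :: "'a::real_normed_vector \<Rightarrow> 'c::real_vector" and g :: "'a \<Rightarrow> real"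
  assumes "open N" "q \<in> N" "q' \<in> N" and fac: "\<And>x. x \<in> N \<Longrightarrow> g x = \<gamma> (L x)"
    and "linear L" "L q = L q'" "L w = L w'"
    and G: "(g has_derivative G) (at q)" and G': "(g has_derivative G') (at q')"
  shows "G w = G' w'"
proof -
  have curve: "((\<lambda>s. q0 + s *\<^sub>R w0) has_derivative (\<lambda>s. s *\<^sub>R w0)) (at (0::real))" for q0 w0 :: 'a
    by (auto intro!: derivative_eq_intros)
  define S where "S = ((\<lambda>s::real. q + s *\<^sub>R w) -` N) \<inter> ((\<lambda>s. q' + s *\<^sub>R w') -` N)"
  have S: "open S" "0 \<in> S"
    unfolding S_def using assms(1-3)
    by (auto intro!: open_Int open_vimage continuous_intros)
  have 1: "((\<lambda>s. g (q + s *\<^sub>R w)) has_derivative (\<lambda>s. G (s *\<^sub>R w))) (at (0::real))"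
    using has_derivative_compose[OF curve, of g G q w] G by simp
  have 2: "((\<lambda>s. g (q' + s *\<^sub>R w')) has_derivative (\<lambda>s. G' (s *\<^sub>R w'))) (at (0::real))"
    using has_derivative_compose[OF curve, of g G' q' w'] G' by simp
  have "g (q + s *\<^sub>R w) = g (q' + s *\<^sub>R w')" if "s \<in> S" for s
    using that fac assms(6,7) by (simp add: S_def linear_add[OF assms(5)] linear_scale[OF assms(5)])
  from has_derivative_transform_within_open[OF 1 S this]
  have "((\<lambda>s. g (q' + s *\<^sub>R w')) has_derivative (\<lambda>s. G (s *\<^sub>R w))) (at (0::real))" by blast
  from has_derivative_unique[OF this 2] have "G (1 *\<^sub>R w) = G' (1 *\<^sub>R w')" by meson
  then show ?thesis by simp
qed

text \<open>On a segment inside a fibre the derivative of \<open>g\<close> is zero, so \<open>g\<close> is locally constant on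
  every fibre. A converse of the previous lemma.\<close>

lemma factors_if_connected_fibres:
  fixes L :: "'a::real_normed_vector \<Rightarrow> 'c::real_vector" and g :: "'a \<Rightarrow> real"
  assumes "open U" "linear L" and conn: "\<And>c. connected {q \<in> U. L q = c}"
    and G: "\<And>q. q \<in> U \<Longrightarrow> (g has_derivative G q) (at q)"
    and ker: "\<And>q w. q \<in> U \<Longrightarrow> L w = 0 \<Longrightarrow> G q w = 0"
  shows "\<exists>\<gamma>. \<forall>q\<in>U. g q = \<gamma> (L q)"
proof -
  have eq: "g q = g q'" if "q \<in> U" "q' \<in> U" "L q = L q'" for q q'
  proof (rule connected_local_const[OF conn[of "L q"]])
    show "\<forall>x\<in>{x \<in> U. L x = L q}. \<forall>\<^sub>F y in at x within {x \<in> U. L x = L q}. g x = g y"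
    proof
      fix x assume x: "x \<in> {x \<in> U. L x = L q}"
      then obtain e where e: "e > 0" "ball x e \<subseteq> U" using assms(1) openE by blast
      have "g x = g y" if y: "y \<in> ball x e" "L y = L q" for y
      proof -
        have xe: "x \<in> ball x e" using e by simp
        have mem: "x + s *\<^sub>R (y - x) \<in> U" if "s \<in> {0..1}" for s :: real
        proof -
          have "(1 - s) *\<^sub>R x + s *\<^sub>R y \<in> ball x e"
            using convexD_alt[OF convex_ball xe y(1)] that by auto
          then show ?thesis using e(2) by (auto simp: algebra_simps)
        qed
        have kerL: "L (s *\<^sub>R (y - x)) = 0" for s
          using y x by (simp add: linear_scale[OF assms(2)] linear_diff[OF assms(2)])
        have curve: "((\<lambda>s. x + s *\<^sub>R (y - x)) has_derivative (\<lambda>s. s *\<^sub>R (y - x))) (at s within {0..1})"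
          for s :: real
          by (auto intro!: derivative_eq_intros)
        have "((\<lambda>s. g (x + s *\<^sub>R (y - x))) has_derivative (\<lambda>s. 0)) (at s within {0..1})"
          if "s \<in> {0..1}" for s :: real
          using has_derivative_compose[where g = g, OF curve G[OF mem[OF that]]]
            ker[OF mem[OF that] kerL] by simp
        from has_derivative_zero_constant[OF _ this]
        obtain c where "\<forall>s\<in>{0..1::real}. g (x + s *\<^sub>R (y - x)) = c" by auto
        from this[rule_format, of 0] this[rule_format, of 1] show ?thesis by simp
      qed
      then show "\<forall>\<^sub>F y in at x within {x \<in> U. L x = L q}. g x = g y"
        unfolding eventually_at_topological using e(1)
        by (intro exI[of _ "ball x e"]) auto
    qed
  qed (use that in auto)
  have "g q = g (SOME r. r \<in> U \<and> L r = L q)" if "q \<in> U" for q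
    using eq[OF that, of "SOME r. r \<in> U \<and> L r = L q"] someI[of "\<lambda>r. r \<in> U \<and> L r = L q" q] that by auto
  then show ?thesis by (intro exI[of _ "\<lambda>c. g (SOME r. r \<in> U \<and> L r = c)"]) auto
qed

section \<open>Maps with diagonal derivative\<close>

text \<open>The diagonal entries of the derivative, \<open>\<partial>\<Phi>\<^sup>0/\<partial>t\<close> and \<open>\<partial>\<Phi>\<^sup>i/\<partial>x\<^sub>i\<close>. Web form itself is
  awkward to compute with, since it quantifies over one-variable functions; being diagonal is its
  pointwise counterpart.\<close>

definition time_scale :: "(real \<times> (real^'n) \<Rightarrow> real \<times> (real^'n)) \<Rightarrow> real \<times> (real^'n) \<Rightarrow> real" where
  "time_scale \<Phi> p = fst (frechet_derivative \<Phi> (at p) (1, 0))"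

definition space_scale :: "(real \<times> (real^'n) \<Rightarrow> real \<times> (real^'n)) \<Rightarrow> 'n \<Rightarrow> real \<times> (real^'n) \<Rightarrow> real" where
  "space_scale \<Phi> i p = snd (frechet_derivative \<Phi> (at p) (0, axis i 1)) $ i"

definition diagonal_on :: "(real \<times> (real^'n)) set \<Rightarrow> (real \<times> (real^'n) \<Rightarrow> real \<times> (real^'n)) \<Rightarrow> bool" where
  "diagonal_on U \<Phi> \<longleftrightarrow> (\<forall>p\<in>U. \<forall>v.
     fst (frechet_derivative \<Phi> (at p) v) = time_scale \<Phi> p * fst v \<and>
     (\<forall>i. snd (frechet_derivative \<Phi> (at p) v) $ i = space_scale \<Phi> i p * snd v $ i))"

lemma diagonal_onD:
  assumes "diagonal_on U \<Phi>" "p \<in> U"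
  shows "fst (frechet_derivative \<Phi> (at p) v) = time_scale \<Phi> p * fst v"
    and "snd (frechet_derivative \<Phi> (at p) v) $ i = space_scale \<Phi> i p * snd v $ i"
  using assms unfolding diagonal_on_def by blast+

lemma linear_snd_nth: "linear (\<lambda>p :: 'a::real_vector \<times> (real^'n). snd p $ i)"
  by (auto intro!: linearI)

lemma bounded_linear_snd_nth: "bounded_linear (\<lambda>p :: 'a::real_normed_vector \<times> (real^'n). snd p $ i)"
  by (rule bounded_linear_compose[OF bounded_linear_vec_nth bounded_linear_snd])

lemma has_derivative_components:
  fixes \<Phi> :: "real \<times> (real^'n) \<Rightarrow> real \<times> (real^'n)"
  assumes "smooth_on U \<Phi>" "p \<in> U"
  shows "((\<lambda>q. fst (\<Phi> q)) has_derivative (\<lambda>v. fst (frechet_derivative \<Phi> (at p) v))) (at p)"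
    and "((\<lambda>q. snd (\<Phi> q) $ i) has_derivative (\<lambda>v. snd (frechet_derivative \<Phi> (at p) v) $ i)) (at p)"
  using bounded_linear.has_derivative[OF bounded_linear_fst smooth_on_has_derivative[OF assms]]
    bounded_linear.has_derivative[OF bounded_linear_snd_nth smooth_on_has_derivative[OF assms]]
  by auto

text \<open>The case \<open>p = q\<close> shows that the derivative is diagonal; distinct points show on which
  coordinate each diagonal entry depends.\<close>

lemma web_form_derivative_eq:
  fixes \<Phi> :: "real \<times> (real^'n) \<Rightarrow> real \<times> (real^'n)"
  assumes "smooth_on U \<Phi>" "open N" "N \<subseteq> U" "web_form N \<Phi>" "p \<in> N" "q \<in> N"
  shows "fst p = fst q \<Longrightarrow> fst v = fst w \<Longrightarrow>
      fst (frechet_derivative \<Phi> (at p) v) = fst (frechet_derivative \<Phi> (at q) w)"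
    and "snd p $ i = snd q $ i \<Longrightarrow> snd v $ i = snd w $ i \<Longrightarrow>
      snd (frechet_derivative \<Phi> (at p) v) $ i = snd (frechet_derivative \<Phi> (at q) w) $ i"
proof -
  obtain \<phi>0 \<phi> where \<phi>: "\<And>t x. (t, x) \<in> N \<Longrightarrow> \<Phi> (t, x) = (\<phi>0 t, (\<chi> i. \<phi> i (x $ i)))"
    using assms(4) unfolding web_form_def by blast
  have f: "fst (\<Phi> q) = \<phi>0 (fst q)" and s: "snd (\<Phi> q) $ i = \<phi> i (snd q $ i)" if "q \<in> N" for q i
    using \<phi>[of "fst q" "snd q"] that by auto
  have U: "p \<in> U" "q \<in> U" using assms by auto
  note D = has_derivative_components[OF assms(1)]
  show "fst p = fst q \<Longrightarrow> fst v = fst w \<Longrightarrow>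
      fst (frechet_derivative \<Phi> (at p) v) = fst (frechet_derivative \<Phi> (at q) w)"
    by (rule derivative_eq_if_factors[OF assms(2,5,6) f linear_fst _ _ D(1)[OF U(1)] D(1)[OF U(2)]])
  show "snd p $ i = snd q $ i \<Longrightarrow> snd v $ i = snd w $ i \<Longrightarrow>
      snd (frechet_derivative \<Phi> (at p) v) $ i = snd (frechet_derivative \<Phi> (at q) w) $ i"
    by (rule derivative_eq_if_factors[OF assms(2,5,6) s linear_snd_nth _ _ D(2)[OF U(1)] D(2)[OF U(2)]])
qed

lemma diagonal_on_if_locally_web_form:
  fixes \<Phi> :: "real \<times> (real^'n) \<Rightarrow> real \<times> (real^'n)"
  assumes "smooth_on U \<Phi>" "locally_web_form U \<Phi>"
  shows "diagonal_on U \<Phi>"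
  unfolding diagonal_on_def
proof (intro ballI allI conjI)
  fix p v i assume p: "p \<in> U"
  let ?D = "frechet_derivative \<Phi> (at p)"
  obtain N where N: "open N" "p \<in> N" "N \<subseteq> U" "web_form N \<Phi>"
    using assms(2) p unfolding locally_web_form_def by blast
  have lin: "linear ?D"
    using smooth_on_has_derivative[OF assms(1) p] has_derivative_linear by blast
  have "fst (?D v) = fst (?D (fst v *\<^sub>R (1, 0)))"
    by (rule web_form_derivative_eq(1)[OF assms(1) N(1,3,4,2,2)]) auto
  then show "fst (?D v) = time_scale \<Phi> p * fst v"
    unfolding linear_scale[OF lin] by (simp add: time_scale_def)
  have "snd (?D v) $ i = snd (?D ((snd v $ i) *\<^sub>R (0, axis i 1))) $ i"
    by (rule web_form_derivative_eq(2)[OF assms(1) N(1,3,4,2,2)]) (auto simp: axis_def)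
  then show "snd (?D v) $ i = space_scale \<Phi> i p * snd v $ i"
    unfolding linear_scale[OF lin] by (simp add: space_scale_def)
qed

lemma web_form_if_diagonal_on:
  fixes \<Phi> :: "real \<times> (real^'n) \<Rightarrow> real \<times> (real^'n)"
  assumes "smooth_on U \<Phi>" "diagonal_on U \<Phi>" "open N" "N \<subseteq> U" "connected_slices N"
  shows "web_form N \<Phi>"
proof -
  have c: "connected {q \<in> N. fst q = c}" "connected {q \<in> N. snd q $ i = c}" for c i
    using assms(5) unfolding connected_slices_def by blast+
  note D = has_derivative_components[OF assms(1) subsetD[OF assms(4)]]
  have "\<exists>\<gamma>. \<forall>q\<in>N. fst (\<Phi> q) = \<gamma> (fst q)"
    by (rule factors_if_connected_fibres[OF assms(3) linear_fst c(1) D(1)])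
      (use assms(2,4) in \<open>auto simp: diagonal_on_def\<close>)
  then obtain \<phi>0 where \<phi>0: "\<And>q. q \<in> N \<Longrightarrow> fst (\<Phi> q) = \<phi>0 (fst q)" by blast
  have "\<exists>\<gamma>. \<forall>q\<in>N. snd (\<Phi> q) $ i = \<gamma> (snd q $ i)" for i
    by (rule factors_if_connected_fibres[OF assms(3) linear_snd_nth c(2) D(2)])
      (use assms(2,4) in \<open>auto simp: diagonal_on_def\<close>)
  then obtain \<phi> where \<phi>: "\<And>q i. q \<in> N \<Longrightarrow> snd (\<Phi> q) $ i = \<phi> i (snd q $ i)" by metis
  have "\<Phi> (t, x) = (\<phi>0 t, (\<chi> i. \<phi> i (x $ i)))" if "(t, x) \<in> N" for t x
    using \<phi>0[OF that] \<phi>[OF that] by (simp add: prod_eq_iff vec_eq_iff)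
  then show ?thesis unfolding web_form_def by blast
qed

lemma connected_slices_ball: "connected_slices (ball p e :: (real \<times> (real^'n)) set)"
proof -
  have fibre: "connected {q \<in> ball p e. L q = c}"
    if "linear L" for L :: "real \<times> (real^'n) \<Rightarrow> real" and c
  proof -
    have "convex (L -` {c})" using convex_linear_vimage[OF that convex_singleton] .
    then have "convex (ball p e \<inter> L -` {c})" by (intro convex_Int convex_ball)
    moreover have "{q \<in> ball p e. L q = c} = ball p e \<inter> L -` {c}" by auto
    ultimately show ?thesis using convex_connected by metis
  qed
  show ?thesis
    unfolding connected_slices_def by (intro conjI allI fibre linear_fst linear_snd_nth)
qed

lemma locally_web_form_if_diagonal_on:
  fixes \<Phi> :: "real \<times> (real^'n) \<Rightarrow> real \<times> (real^'n)"
  assumes "open U" "smooth_on U \<Phi>" "diagonal_on U \<Phi>"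
  shows "locally_web_form U \<Phi>"
  unfolding locally_web_form_def
proof
  fix p assume "p \<in> U"
  then obtain e where e: "e > 0" "ball p e \<subseteq> U" using assms(1) openE by blast
  have "web_form (ball p e) \<Phi>"
    by (rule web_form_if_diagonal_on[OF assms(2,3) open_ball e(2) connected_slices_ball])
  then show "\<exists>N. open N \<and> p \<in> N \<and> N \<subseteq> U \<and> web_form N \<Phi>"
    using e by (intro exI[of _ "ball p e"]) auto
qed

section \<open>The equivalence problems\<close>

lemma smooth_on_diagonal_matrix:
  fixes d :: "'n::finite \<Rightarrow> 'a::real_normed_vector \<Rightarrow> real"
  assumes "open U" "\<And>i. smooth_on U (d i)"
  shows "smooth_on U (\<lambda>p. \<chi> i j. if i = j then d i p else 0)"
proof -
  let ?E = "\<lambda>k. (\<chi> i j. if i = k \<and> j = k then 1 else 0) :: real^'n^'n"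
  have "smooth_on U (\<lambda>p. \<Sum>k\<in>UNIV. d k p *\<^sub>R ?E k)"
    by (intro smooth_on_sum smooth_on_linear_left[OF assms(1) bounded_linear_scaleR_left] assms) simp
  moreover have "(\<Sum>k\<in>UNIV. d k p *\<^sub>R ?E k) = (\<chi> i j. if i = j then d i p else 0)" for p
  proof -
    have "(\<Sum>k\<in>UNIV. d k p *\<^sub>R ?E k) $ i $ j = (\<Sum>k\<in>UNIV. if k = i then if i = j then d i p else 0 else 0)"
      for i j
      unfolding sum_component by (intro sum.cong) auto
    then show ?thesis by (simp add: vec_eq_iff)
  qed
  ultimately show ?thesis by simp
qed

text \<open>Evaluating the defining identity at the coordinate vectors of \<open>x\<^sub>j\<close> forces the matrix to be
  diagonal with entries \<open>space_scale \<Phi> i\<close>, and evaluating it at \<open>\<partial>/\<partial>t\<close> gives the relation between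
  \<open>f\<close> and \<open>F\<close>.\<close>

lemma maps_integral_curves_iff:
  fixes f F :: "real^'n \<Rightarrow> real^'n"
  assumes "open U" "smooth_on U \<Phi>" "diagonal_on U \<Phi>"
  shows "maps_integral_curves U f F \<Phi> \<longleftrightarrow>
    (\<forall>p\<in>U. \<forall>i. space_scale \<Phi> i p \<noteq> 0 \<and>
       time_scale \<Phi> p * F (snd (\<Phi> p)) $ i = space_scale \<Phi> i p * f (snd p) $ i)"
    (is "_ \<longleftrightarrow> ?R")
proof -
  have pb: "pullback \<Phi> (\<lambda>q w. dx i q w - F (snd q) $ i * dt q w) p v
      = space_scale \<Phi> i p * snd v $ i - F (snd (\<Phi> p)) $ i * (time_scale \<Phi> p * fst v)"
    if "p \<in> U" for p v i
    by (simp add: pullback_def dx_apply dt_apply diagonal_onD[OF assms(3) that])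
  show ?thesis
  proof
    assume "maps_integral_curves U f F \<Phi>"
    then obtain a :: "real \<times> (real^'n) \<Rightarrow> real^'n^'n" where inv: "\<And>p. p \<in> U \<Longrightarrow> invertible (a p)"
      and pb_a: "\<And>i p v. p \<in> U \<Longrightarrow> pullback \<Phi> (\<lambda>q w. dx i q w - F (snd q) $ i * dt q w) p v
          = (\<Sum>j\<in>UNIV. a p $ i $ j * (dx j p v - f (snd p) $ j * dt p v))"
      unfolding maps_integral_curves_def by blast
    have a: "space_scale \<Phi> i p * snd v $ i - F (snd (\<Phi> p)) $ i * (time_scale \<Phi> p * fst v)
        = (\<Sum>j\<in>UNIV. a p $ i $ j * (snd v $ j - f (snd p) $ j * fst v))" if "p \<in> U" for i p v
      using trans[OF pb[OF that, of i v, symmetric] pb_a[OF that, of i v]]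
      by (simp only: dx_apply dt_apply)
    show ?R
    proof (intro ballI allI)
      fix p i assume p: "p \<in> U"
      have a_eq: "a p $ i $ j = (if i = j then space_scale \<Phi> i p else 0)" for i j
      proof -
        have "(\<Sum>k\<in>UNIV. a p $ i $ k * axis j 1 $ k) = (\<Sum>k\<in>UNIV. if k = j then a p $ i $ k else 0)"
          by (rule sum.cong) (auto simp: axis_def)
        then have "space_scale \<Phi> i p * axis j 1 $ i = a p $ i $ j"
          using a[OF p, of i "(0, axis j 1)"] by simp
        then show ?thesis by (auto simp: axis_def split: if_splits)
      qed
      have "det (a p) = (\<Prod>i\<in>UNIV. space_scale \<Phi> i p)"
        by (subst det_diagonal) (simp_all add: a_eq)
      then have "space_scale \<Phi> i p \<noteq> 0" using inv[OF p] by (auto simp: invertible_det_nz)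
      moreover have "F (snd (\<Phi> p)) $ i * time_scale \<Phi> p = space_scale \<Phi> i p * f (snd p) $ i"
        using a[OF p, of i "(1, 0)"] by (simp add: a_eq sum_negf if_distrib[of "\<lambda>x. x * _"] cong: if_cong)
      ultimately show "space_scale \<Phi> i p \<noteq> 0 \<and>
          time_scale \<Phi> p * F (snd (\<Phi> p)) $ i = space_scale \<Phi> i p * f (snd p) $ i"
        by (simp add: mult.commute)
    qed
  next
    assume R: ?R
    define a :: "real \<times> (real^'n) \<Rightarrow> real^'n^'n"
      where "a p = (\<chi> i j. if i = j then space_scale \<Phi> i p else 0)" for p
    have "smooth_on U (space_scale \<Phi> i)" for i
      unfolding space_scale_def[abs_def]
      by (intro smooth_on_linear_left[OF assms(1) bounded_linear_snd_nth] smooth_on_frechet_derivative assms)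
    then have "smooth_on U a"
      unfolding a_def[abs_def] by (rule smooth_on_diagonal_matrix[OF assms(1)])
    moreover have "invertible (a p)" if "p \<in> U" for p
    proof -
      have "det (a p) = (\<Prod>i\<in>UNIV. space_scale \<Phi> i p)"
        by (subst det_diagonal) (simp_all add: a_def)
      then show ?thesis using R that by (simp add: invertible_det_nz)
    qed
    moreover have "pullback \<Phi> (\<lambda>q w. dx i q w - F (snd q) $ i * dt q w) p v =
        (\<Sum>j\<in>UNIV. a p $ i $ j * (dx j p v - f (snd p) $ j * dt p v))" if "p \<in> U" for i p v
    proof -
      have "time_scale \<Phi> p * F (snd (\<Phi> p)) $ i = space_scale \<Phi> i p * f (snd p) $ i"
        using R that by blast
      then have "F (snd (\<Phi> p)) $ i * (time_scale \<Phi> p * fst v) = space_scale \<Phi> i p * f (snd p) $ i * fst v"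
        by (metis mult.assoc mult.commute)
      moreover have "(\<Sum>j\<in>UNIV. a p $ i $ j * (snd v $ j - f (snd p) $ j * fst v))
          = space_scale \<Phi> i p * (snd v $ i - f (snd p) $ i * fst v)"
        by (simp add: a_def if_distrib[of "\<lambda>x. x * _"] cong: if_cong)
      ultimately show ?thesis
        unfolding pb[OF that] by (simp add: dx_apply dt_apply right_diff_distrib)
    qed
    ultimately show "maps_integral_curves U f F \<Phi>" unfolding maps_integral_curves_def by blast
  qed
qed

text \<open>Every member of the coframe is a nowhere zero multiple of a coordinate differential, so
  preserving the coframe forces the derivative to be diagonal.\<close>

lemma preserves_web_coframe_iff:
  fixes f F :: "real^'n \<Rightarrow> real^'n"
  assumes "regular_system a b U f" "regular_system a b V F" "\<Phi> ` U \<subseteq> V"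
  shows "(\<forall>k. \<forall>p\<in>U. \<forall>v. pullback \<Phi> (web_coframe a b F k) p v = web_coframe a b f k p v) \<longleftrightarrow>
    diagonal_on U \<Phi> \<and> (\<forall>p\<in>U.
      ell F a b (snd (\<Phi> p)) * time_scale \<Phi> p = ell f a b (snd p) \<and>
      (\<forall>i. space_scale \<Phi> i p * f (snd p) $ i = time_scale \<Phi> p * F (snd (\<Phi> p)) $ i))"
    (is "?L \<longleftrightarrow> _ \<and> (\<forall>p\<in>U. ?A p \<and> (\<forall>i. ?B i p))")
proof -
  let ?D = "\<lambda>p. frechet_derivative \<Phi> (at p)"
  have nz: "f (snd p) $ i \<noteq> 0" "ell f a b (snd p) \<noteq> 0" "F (snd (\<Phi> p)) $ i \<noteq> 0" "ell F a b (snd (\<Phi> p)) \<noteq> 0"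
    if "p \<in> U" for p i
    using assms that by (auto simp: regular_system_def)
  have L: "?L \<longleftrightarrow> (\<forall>p\<in>U. \<forall>v.
      ell F a b (snd (\<Phi> p)) * fst (?D p v) = ell f a b (snd p) * fst v \<and>
      (\<forall>i. ell F a b (snd (\<Phi> p)) / F (snd (\<Phi> p)) $ i * snd (?D p v) $ i
        = ell f a b (snd p) / f (snd p) $ i * snd v $ i))"
    unfolding split_option_all by (auto simp: pullback_def dt_apply dx_apply)
  show ?thesis
  proof
    assume ?L
    then have t: "ell F a b (snd (\<Phi> p)) * fst (?D p v) = ell f a b (snd p) * fst v"
      and s: "ell F a b (snd (\<Phi> p)) / F (snd (\<Phi> p)) $ i * snd (?D p v) $ i
        = ell f a b (snd p) / f (snd p) $ i * snd v $ i" if "p \<in> U" for p v i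
      using that unfolding L by blast+
    have A: "?A p" if "p \<in> U" for p
      using t[OF that, of "(1, 0)"] by (simp add: time_scale_def)
    have C: "ell F a b (snd (\<Phi> p)) / F (snd (\<Phi> p)) $ i * space_scale \<Phi> i p = ell f a b (snd p) / f (snd p) $ i"
      if "p \<in> U" for p i
      using s[OF that, of i "(0, axis i 1)"] by (simp add: space_scale_def)
    have "diagonal_on U \<Phi>"
      unfolding diagonal_on_def
    proof (intro ballI allI conjI)
      fix p v i assume p: "p \<in> U"
      have "ell F a b (snd (\<Phi> p)) * fst (?D p v) = ell F a b (snd (\<Phi> p)) * (time_scale \<Phi> p * fst v)"
        using t[OF p, of v] A[OF p] by (simp add: mult.assoc[symmetric])
      then show "fst (?D p v) = time_scale \<Phi> p * fst v" using nz[OF p] by simp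
      have "ell F a b (snd (\<Phi> p)) / F (snd (\<Phi> p)) $ i * snd (?D p v) $ i
        = ell F a b (snd (\<Phi> p)) / F (snd (\<Phi> p)) $ i * (space_scale \<Phi> i p * snd v $ i)"
        using s[OF p, of i v] C[OF p, of i] by (simp only: mult.assoc[symmetric])
      then show "snd (?D p v) $ i = space_scale \<Phi> i p * snd v $ i" using nz[OF p] by simp
    qed
    moreover have "?B i p" if "p \<in> U" for i p
    proof -
      have "ell F a b (snd (\<Phi> p)) * (space_scale \<Phi> i p * f (snd p) $ i) = ell f a b (snd p) * F (snd (\<Phi> p)) $ i"
        using C[OF that, of i] nz[OF that] by (simp add: field_simps)
      also have "\<dots> = ell F a b (snd (\<Phi> p)) * (time_scale \<Phi> p * F (snd (\<Phi> p)) $ i)"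
        using A[OF that] by simp
      finally show ?thesis using nz[OF that] by simp
    qed
    ultimately show "diagonal_on U \<Phi> \<and> (\<forall>p\<in>U. ?A p \<and> (\<forall>i. ?B i p))" using A by blast
  next
    assume R: "diagonal_on U \<Phi> \<and> (\<forall>p\<in>U. ?A p \<and> (\<forall>i. ?B i p))"
    show ?L
      unfolding L
    proof (intro ballI allI conjI)
      fix p v i assume p: "p \<in> U"
      then have A: "ell f a b (snd p) = ell F a b (snd (\<Phi> p)) * time_scale \<Phi> p"
        and B: "space_scale \<Phi> i p = time_scale \<Phi> p * F (snd (\<Phi> p)) $ i / f (snd p) $ i"
        and D: "fst (?D p v) = time_scale \<Phi> p * fst v" "snd (?D p v) $ i = space_scale \<Phi> i p * snd v $ i"
        using R nz[OF p] diagonal_onD[of U \<Phi> p] by (simp_all add: eq_divide_eq)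
      show "ell F a b (snd (\<Phi> p)) * fst (?D p v) = ell f a b (snd p) * fst v"
        by (simp add: D A)
      show "ell F a b (snd (\<Phi> p)) / F (snd (\<Phi> p)) $ i * snd (?D p v) $ i
        = ell f a b (snd p) / f (snd p) $ i * snd v $ i"
        unfolding D B A using nz[OF p] by simp
    qed
  qed
qed

text \<open>The reason why multiplying by \<open>ell f a b\<close> makes \<open>dt\<close> invariant. The proof follows the line
  through \<open>p\<close> in the direction of \<open>x\<^sub>b\<close>.\<close>

lemma ell_transform:
  fixes f F :: "real^'n \<Rightarrow> real^'n"
  assumes "a \<noteq> b" "regular_system a b U f" "regular_system a b V F" "\<Phi> ` U \<subseteq> V"
    and sm: "smooth_on U \<Phi>" and web: "locally_web_form U \<Phi>"
    and nz: "\<And>p i. p \<in> U \<Longrightarrow> space_scale \<Phi> i p \<noteq> 0"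
    and rel: "\<And>p i. p \<in> U \<Longrightarrow> time_scale \<Phi> p * F (snd (\<Phi> p)) $ i = space_scale \<Phi> i p * f (snd p) $ i"
    and p: "p \<in> U"
  shows "ell F a b (snd (\<Phi> p)) * time_scale \<Phi> p = ell f a b (snd p)"
proof -
  obtain N where N: "open N" "p \<in> N" "N \<subseteq> U" "web_form N \<Phi>"
    using web p unfolding locally_web_form_def by blast
  have fnz: "f (snd q) $ i \<noteq> 0" if "q \<in> U" for q i
    using assms(2) that by (auto simp: regular_system_def)
  have tnz: "time_scale \<Phi> q \<noteq> 0" if "q \<in> U" for q
    using rel[OF that, of a] nz[OF that] fnz[OF that] by auto
  let ?k = "\<lambda>y. ln \<bar>f y $ a\<bar>" and ?K = "\<lambda>y. ln \<bar>F y $ a\<bar>"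
  let ?\<delta> = "space_scale \<Phi> a p / time_scale \<Phi> p"
  define c where "c s = p + s *\<^sub>R (0, axis b 1)" for s :: real
  have c0: "c 0 = p" by (simp add: c_def zero_prod_def[symmetric])
  have c: "(c has_derivative (\<lambda>s. s *\<^sub>R (0, axis b 1))) (at 0)"
    unfolding c_def[abs_def]
    using has_derivative_add[OF has_derivative_const bounded_linear_imp_has_derivative[OF bounded_linear_scaleR_left]]
    by (simp only: add_0)
  define S where "S = c -` N"
  have "continuous_on UNIV c"
    unfolding c_def[abs_def] by (intro continuous_intros)
  then have S: "open S" "0 \<in> S"
    using open_vimage[OF N(1)] N(2) by (simp_all add: S_def c0)
  \<comment> \<open>\<open>?\<delta>\<close> stays constant along \<open>c\<close>: moving in the direction \<open>b \<noteq> a\<close> changes neither \<open>t\<close> nor \<open>x\<^sub>a\<close>.\<close>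
  have eq: "?K (snd (\<Phi> (c s))) = ln \<bar>?\<delta>\<bar> + ?k (snd (c s))" if "s \<in> S" for s
  proof -
    have cN: "c s \<in> N" and cU: "c s \<in> U" using that N by (auto simp: S_def)
    have "time_scale \<Phi> (c s) = time_scale \<Phi> p"
      unfolding time_scale_def
      by (rule web_form_derivative_eq(1)[OF sm N(1,3,4) cN N(2)]) (auto simp: c_def)
    moreover have "space_scale \<Phi> a (c s) = space_scale \<Phi> a p"
      unfolding space_scale_def
      by (rule web_form_derivative_eq(2)[OF sm N(1,3,4) cN N(2)]) (use assms(1) in \<open>auto simp: c_def axis_def\<close>)
    ultimately have "F (snd (\<Phi> (c s))) $ a = ?\<delta> * f (snd (c s)) $ a"
      using rel[OF cU, of a] tnz[OF p] by (simp add: field_simps)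
    moreover have "?\<delta> \<noteq> 0" using nz[OF p] tnz[OF p] by simp
    ultimately show ?thesis
      using fnz[OF cU, of a] by (simp only: abs_mult) (subst ln_mult; simp)
  qed
  have snd_deriv: "snd (frechet_derivative \<Phi> (at p) (0, axis b 1)) = space_scale \<Phi> b p *\<^sub>R axis b 1"
    using diagonal_on_if_locally_web_form[OF sm web] p
    by (simp add: diagonal_on_def vec_eq_iff axis_def)
  have curve: "((\<lambda>s. snd (c s)) has_derivative (\<lambda>s. s *\<^sub>R axis b 1)) (at 0)"
    using has_derivative_snd[OF c] by simp
  have image_curve: "((\<lambda>s. snd (\<Phi> (c s))) has_derivative (\<lambda>s. s *\<^sub>R (space_scale \<Phi> b p *\<^sub>R axis b 1))) (at 0)"
  proof -
    have D: "(\<Phi> has_derivative frechet_derivative \<Phi> (at p)) (at (c 0))"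
      using smooth_on_has_derivative[OF sm p] c0 by simp
    have "((\<lambda>s. snd (\<Phi> (c s))) has_derivative (\<lambda>s. snd (frechet_derivative \<Phi> (at p) (s *\<^sub>R (0, axis b 1))))) (at 0)"
      using has_derivative_snd[OF has_derivative_compose[OF c D]] .
    then show ?thesis
      unfolding linear_scale[OF has_derivative_linear[OF D]] snd_scaleR snd_deriv .
  qed
  have k: "(?k has_derivative frechet_derivative ?k (at (snd p))) (at (snd (c 0)))"
    using regular_system_ln_has_derivative[OF assms(2)] p c0
      frechet_derivative_works differentiableI by (metis imageI)
  have K: "(?K has_derivative frechet_derivative ?K (at (snd (\<Phi> p)))) (at (snd (\<Phi> (c 0))))"
    using regular_system_ln_has_derivative[OF assms(3)] p c0 assms(4)
      frechet_derivative_works differentiableI by (metis imageI image_subset_iff)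
  have "((\<lambda>s. ln \<bar>?\<delta>\<bar> + ?k (snd (c s))) has_derivative
      (\<lambda>s. frechet_derivative ?k (at (snd p)) (s *\<^sub>R axis b 1))) (at 0)"
    using has_derivative_add[OF has_derivative_const has_derivative_compose[OF curve k]] by simp
  from has_derivative_transform_within_open[OF this S eq[symmetric]]
  have "((\<lambda>s. ?K (snd (\<Phi> (c s)))) has_derivative
      (\<lambda>s. frechet_derivative ?k (at (snd p)) (s *\<^sub>R axis b 1))) (at 0)" by blast
  from has_derivative_unique[OF this has_derivative_compose[OF image_curve K]]
  have "frechet_derivative ?k (at (snd p)) (1 *\<^sub>R axis b 1)
      = frechet_derivative ?K (at (snd (\<Phi> p))) (1 *\<^sub>R (space_scale \<Phi> b p *\<^sub>R axis b 1))" by meson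
  then have "partial b ?k (snd p) = space_scale \<Phi> b p * partial b ?K (snd (\<Phi> p))"
    by (simp add: partial_def linear_scale[OF has_derivative_linear[OF K]])
  then show ?thesis
    using rel[OF p, of b] by (simp add: ell_def mult.commute mult.left_commute)
qed

lemma local_web_equivalence_iff_e_equivalence:
  fixes f F :: "real^'n \<Rightarrow> real^'n"
  assumes "a \<noteq> b" "regular_system a b U f" "regular_system a b V F"
  shows "local_web_equivalence U f V F \<Phi> \<longleftrightarrow>
    e_equivalence U (web_coframe a b f) V (web_coframe a b F) \<Phi>"
proof (cases "diffeomorphism_on U V \<Phi>")
  case True
  then have sm: "smooth_on U \<Phi>" and im: "\<Phi> ` U \<subseteq> V"
    by (auto simp: diffeomorphism_on_def bij_betw_def)
  have oU: "open U" using assms(2) by (simp add: regular_system_def)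
  note e_iff = preserves_web_coframe_iff[OF assms(2,3) im]
  have nz: "f (snd p) $ i \<noteq> 0" "ell f a b (snd p) \<noteq> 0" "F (snd (\<Phi> p)) $ i \<noteq> 0" if "p \<in> U" for p i
    using assms im that by (auto simp: regular_system_def)
  have "locally_web_form U \<Phi> \<and> maps_integral_curves U f F \<Phi> \<longleftrightarrow>
      (\<forall>k. \<forall>p\<in>U. \<forall>v. pullback \<Phi> (web_coframe a b F k) p v = web_coframe a b f k p v)"
    unfolding e_iff
  proof
    assume l: "locally_web_form U \<Phi> \<and> maps_integral_curves U f F \<Phi>"
    then have d: "diagonal_on U \<Phi>" using diagonal_on_if_locally_web_form[OF sm] by blast
    with l have m: "space_scale \<Phi> i p \<noteq> 0"
      "time_scale \<Phi> p * F (snd (\<Phi> p)) $ i = space_scale \<Phi> i p * f (snd p) $ i" if "p \<in> U" for p i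
      using maps_integral_curves_iff[OF oU sm d] that by blast+
    have "ell F a b (snd (\<Phi> p)) * time_scale \<Phi> p = ell f a b (snd p)" if "p \<in> U" for p
      by (rule ell_transform[OF assms im sm conjunct1[OF l] m that])
    with d m show "diagonal_on U \<Phi> \<and> (\<forall>p\<in>U.
      ell F a b (snd (\<Phi> p)) * time_scale \<Phi> p = ell f a b (snd p) \<and>
      (\<forall>i. space_scale \<Phi> i p * f (snd p) $ i = time_scale \<Phi> p * F (snd (\<Phi> p)) $ i))" by simp
  next
    assume r: "diagonal_on U \<Phi> \<and> (\<forall>p\<in>U.
      ell F a b (snd (\<Phi> p)) * time_scale \<Phi> p = ell f a b (snd p) \<and>
      (\<forall>i. space_scale \<Phi> i p * f (snd p) $ i = time_scale \<Phi> p * F (snd (\<Phi> p)) $ i))"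
    then have d: "diagonal_on U \<Phi>" by blast
    have rel: "space_scale \<Phi> i p * f (snd p) $ i = time_scale \<Phi> p * F (snd (\<Phi> p)) $ i"
      and t: "time_scale \<Phi> p \<noteq> 0" if "p \<in> U" for p i
      using r that nz(2)[OF that] by auto
    have "space_scale \<Phi> i p \<noteq> 0" if "p \<in> U" for p i
      using rel[OF that, of i] t[OF that] nz(3)[OF that, of i] by auto
    then have "maps_integral_curves U f F \<Phi>"
      unfolding maps_integral_curves_iff[OF oU sm d] using rel by simp
    then show "locally_web_form U \<Phi> \<and> maps_integral_curves U f F \<Phi>"
      using locally_web_form_if_diagonal_on[OF oU sm d] by blast
  qed
  then show ?thesis using True by (simp add: local_web_equivalence_def e_equivalence_def)
qed (simp add: local_web_equivalence_def e_equivalence_def)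

lemma web_equivalence_iff_local_web_equivalence:
  assumes "open U" "connected_slices U"
  shows "web_equivalence U f V F \<Phi> \<longleftrightarrow> local_web_equivalence U f V F \<Phi>"
proof -
  have "web_form U \<Phi> \<longleftrightarrow> locally_web_form U \<Phi>" if "smooth_on U \<Phi>"
  proof
    assume "web_form U \<Phi>"
    then show "locally_web_form U \<Phi>" unfolding locally_web_form_def using assms(1) by blast
  next
    assume "locally_web_form U \<Phi>"
    from diagonal_on_if_locally_web_form[OF that this]
    show "web_form U \<Phi>" by (rule web_form_if_diagonal_on[OF that _ assms(1) order_refl assms(2)])
  qed
  then show ?thesis
    by (auto simp: web_equivalence_def local_web_equivalence_def diffeomorphism_on_def)
qed

theorem mainTheorem3:
  fixes U :: "(real \<times> (real^'n)) set" and f :: "real^'n \<Rightarrow> real^'n" and a b :: 'n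
  assumes "CARD('n) \<ge> 2" and "a \<noteq> b" and "regular_system a b U f"
  shows "coframe_on U (web_coframe a b f) \<and>
    (\<forall>p\<in>U. \<forall>u v. ext_deriv (web_coframe a b f None) p u v =
       - (\<Sum>i\<in>UNIV. dlog_ell a b f i (snd p)
          * wedge (web_coframe a b f None) (web_coframe a b f (Some i)) p u v)) \<and>
    (\<forall>i. \<forall>p\<in>U. \<forall>u v. ext_deriv (web_coframe a b f (Some i)) p u v =
       (\<Sum>j\<in>UNIV. (ell f i j (snd p) / ell f a b (snd p) - dlog_ell a b f j (snd p))
          * wedge (web_coframe a b f (Some i)) (web_coframe a b f (Some j)) p u v)) \<and>
    (\<forall>V F \<Phi>. regular_system a b V F \<longrightarrow>
       (local_web_equivalence U f V F \<Phi> \<longleftrightarrow>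
          e_equivalence U (web_coframe a b f) V (web_coframe a b F) \<Phi>) \<and>
       (connected_slices U \<longrightarrow>
          (web_equivalence U f V F \<Phi> \<longleftrightarrow>
             e_equivalence U (web_coframe a b f) V (web_coframe a b F) \<Phi>)))"
proof (intro conjI ballI allI impI)
  show "coframe_on U (web_coframe a b f)" by (rule coframe_on_web_coframe[OF assms(3)])
next
  fix p u v assume "p \<in> U"
  then show "ext_deriv (web_coframe a b f None) p u v =
       - (\<Sum>i\<in>UNIV. dlog_ell a b f i (snd p)
          * wedge (web_coframe a b f None) (web_coframe a b f (Some i)) p u v)"
    by (rule ext_deriv_web_coframe_None[OF assms(3)])
next
  fix i p u v assume "p \<in> U"
  then show "ext_deriv (web_coframe a b f (Some i)) p u v =
       (\<Sum>j\<in>UNIV. (ell f i j (snd p) / ell f a b (snd p) - dlog_ell a b f j (snd p))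
          * wedge (web_coframe a b f (Some i)) (web_coframe a b f (Some j)) p u v)"
    by (rule ext_deriv_web_coframe_Some[OF assms(3)])
next
  fix V F \<Phi> assume F: "regular_system a b V F"
  show loc: "local_web_equivalence U f V F \<Phi> \<longleftrightarrow>
      e_equivalence U (web_coframe a b f) V (web_coframe a b F) \<Phi>"
    by (rule local_web_equivalence_iff_e_equivalence[OF assms(2,3) F])
  assume "connected_slices U"
  moreover have "open U" using assms(3) by (simp add: regular_system_def)
  ultimately show "web_equivalence U f V F \<Phi> \<longleftrightarrow>
      e_equivalence U (web_coframe a b f) V (web_coframe a b F) \<Phi>"
    using web_equivalence_iff_local_web_equivalence loc by blast
qed

end
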